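(* Let $b,c$ be positive integers with $b>1$ and $\gcd(b,c)=1$, and let $\mathcal{L}$ be the equation $b(x+y)=cz$. (i) If $c>2b$ then, for every integer $n>0$, the set $$A_n=\left(\tfrac{2bn}{c},n\right]\cup\left\{x\in\left[1,\tfrac{2bn}{c}\right]: x\not\equiv 0\pmod b\right\}$$ is an $\mathcal{L}$-avoiding subset of $[1,n]$ of maximum size. (ii) If $2\le c<2b$ then, for every integer $n>0$, the set $$A'_n=\{x\in[1,n]: x\not\equiv 0\pmod b\}$$ is an $\mathcal{L}$-avoiding subset of $[1,n]$ of maximum size. (iii) If $c=1$ then, for every integer $n>0$, the set $$A''_n=\left(\tfrac{n}{2b},n\right]$$ is an $\mathcal{L}$-avoiding subset of $[1,n]$ of maximum size.
   Context: All intervals denote sets of integers, e.g. $[\alpha,\beta]=\{x\in\mathbb{Z}:\alpha\le x\le\beta\}$ and $(\alpha,\beta]=\{x\in\mathbb{Z}:\alpha<x\le\beta\}$. A set $A$ of positive integers is $\mathcal{L}$-avoiding if there are no $x,y,z\in A$ (not necessarily distinct) satisfying the equation $\mathcal{L}$. *)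

theory Defs
  imports Complex_Main "HOL-Number_Theory.Cong"
begin

text \<open>An equation in three unknowns is given by its solution predicate. Elements of the set
  need not be distinct. Sets of positive integers are rendered as sets of type \<open>nat set\<close>
  contained in \<open>{1..}\<close>.\<close>

definition avoiding :: "(nat \<Rightarrow> nat \<Rightarrow> nat \<Rightarrow> bool) \<Rightarrow> nat set \<Rightarrow> bool" where
  "avoiding L A \<longleftrightarrow> \<not> (\<exists>x\<in>A. \<exists>y\<in>A. \<exists>z\<in>A. L x y z)"

definition max_avoiding_subset :: "(nat \<Rightarrow> nat \<Rightarrow> nat \<Rightarrow> bool) \<Rightarrow> nat \<Rightarrow> nat set \<Rightarrow> bool" where
  "max_avoiding_subset L n A \<longleftrightarrow>
     A \<subseteq> {1..n} \<and> avoiding L A \<and>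
     (\<forall>B. B \<subseteq> {1..n} \<and> avoiding L B \<longrightarrow> card B \<le> card A)"

end

theory Submission
  imports Defs
begin

text \<open>Everything is phrased through the gaps of an avoiding set \<open>B\<close>, that is, the elements of
  \<open>{1..n}\<close> outside \<open>B\<close>. Because \<open>b\<close> and \<open>c\<close> are coprime, the equation forces \<open>z = b * m\<close> and
  \<open>x + y = c * m\<close>. For \<open>c \<ge> 2\<close> the extremal set therefore only has to leave out multiples of \<open>b\<close>,
  namely those \<open>b * m\<close> for which \<open>c * m\<close> can be a sum of two elements of \<open>{1..n}\<close>; for \<open>c = 1\<close> it
  leaves out an initial segment, so that \<open>b * (x + y)\<close> exceeds \<open>n\<close>. What remains is to show that
  every avoiding \<open>B\<close> has at least as many gaps.

  The source of gaps is a reflection: as soon as \<open>b * m \<in> B\<close>, the map \<open>x \<mapsto> c * m - x\<close> sends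
  elements of \<open>B\<close> to gaps, so at least half of every interval of positive integers centred at
  \<open>c * m / 2\<close> consists of gaps (\<open>half_of_window_missing\<close>). Multiples of \<open>b\<close> that are absent from
  \<open>B\<close> are gaps as well, and the proofs play these two facts against each other.

  For \<open>c \<ge> 2\<close> this is done by strong induction on \<open>n\<close> (\<open>missing_lower_bound_large_c\<close>,
  \<open>missing_lower_bound_medium_c\<close>). If \<open>b * m \<in> B\<close> with \<open>n < c * m \<le> 2 * n\<close>, the interval
  \<open>{c * m - n..n}\<close> is centred correctly, half of it are gaps, and the induction hypothesis takes
  care of what lies to its left. If \<open>b * m \<in> B\<close> with \<open>c * m \<le> n\<close>, the interval \<open>{1..c * m - 1}\<close>
  is used instead. For \<open>c = 1\<close> one gap is needed for every block of \<open>2 * b\<close> integers, and a simple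
  induction over the blocks suffices (\<open>missing_lower_bound_c_one\<close>).\<close>

section \<open>Gaps of an avoiding set\<close>

text \<open>The reflection \<open>x \<mapsto> s - x\<close> preserves the interval and injects its part inside \<open>B\<close> into its
  part outside. Taking \<open>x = y\<close> in the hypothesis rules out the fixed point \<open>s / 2\<close>, so no
  rounding loss occurs.\<close>

lemma reflection_free_half_missing:
  fixes B :: "nat set"
  assumes sum: "lo + hi = s"
    and free: "\<And>x y. x \<in> B \<Longrightarrow> y \<in> B \<Longrightarrow> x + y \<noteq> s"
  shows "card {lo..hi} \<le> 2 * card ({lo..hi} - B)"
proof -
  have "card ({lo..hi} \<inter> B) \<le> card ({lo..hi} - B)"
  proof (rule card_inj_on_le[where f = "\<lambda>x. s - x"])
    show "inj_on (\<lambda>x. s - x) ({lo..hi} \<inter> B)"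
      using sum by (auto simp: inj_on_def)
    show "(\<lambda>x. s - x) ` ({lo..hi} \<inter> B) \<subseteq> {lo..hi} - B"
    proof safe
      fix x assume x: "x \<in> {lo..hi}" "x \<in> B"
      show "s - x \<in> {lo..hi}" using x sum by auto
      assume "s - x \<in> B"
      then show False using free[OF x(2), of "s - x"] x sum by auto
    qed
  qed simp
  moreover have "card {lo..hi} = card ({lo..hi} \<inter> B) + card ({lo..hi} - B)"
    by (rule card_Int_Diff) simp
  ultimately show ?thesis by linarith
qed

text \<open>The length of the interval is bounded by twice the number of gaps, rather than the number of gaps
  by half the length, so that the rounding is left to the later arithmetic.\<close>

lemma half_of_window_missing:
  fixes b c m :: nat
  assumes "avoiding (\<lambda>x y z. b * (x + y) = c * z) B" and "b * m \<in> B" and "lo + hi = c * m"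
  shows "hi + 1 - lo \<le> 2 * card ({lo..hi} - B)"
proof -
  have "x + y \<noteq> c * m" if "x \<in> B" "y \<in> B" for x y
  proof
    assume "x + y = c * m"
    then have "b * (x + y) = c * (b * m)" by simp
    with assms(1,2) that show False unfolding avoiding_def by blast
  qed
  from reflection_free_half_missing[OF assms(3) this] show ?thesis by simp
qed

lemma missing_split:
  fixes B :: "nat set"
  assumes "X \<union> Y \<subseteq> {1..n}" and "X \<inter> Y = {}"
  shows "card (X - B) + card (Y - B) \<le> card ({1..n} - B)"
proof -
  have "finite X" "finite Y" using assms(1) finite_subset[of _ "{1..n}"] by auto
  then have "card (X - B) + card (Y - B) = card ((X - B) \<union> (Y - B))"
    using assms(2) by (intro card_Un_disjoint[symmetric]) auto
  also have "\<dots> \<le> card ({1..n} - B)"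
    using assms(1) by (intro card_mono) auto
  finally show ?thesis .
qed

lemma missing_mono:
  fixes B :: "nat set"
  assumes "X \<subseteq> {1..n}"
  shows "card (X - B) \<le> card ({1..n} - B)"
  using missing_split[of X "{}" n B] assms by simp

lemma max_avoiding_subsetI:
  assumes "A \<subseteq> {1..n}" and "avoiding L A" and "card ({1..n} - A) \<le> k"
    and "\<And>B. avoiding L B \<Longrightarrow> k \<le> card ({1..n} - B)"
  shows "max_avoiding_subset L n A"
  unfolding max_avoiding_subset_def
proof (intro conjI allI impI)
  fix B assume B: "B \<subseteq> {1..n} \<and> avoiding L B"
  have count: "card ({1..n} - X) + card X = n" if "X \<subseteq> {1..n}" for X
    using that card_mono[of "{1..n}" X] by (simp add: card_Diff_subset finite_subset)
  have "card ({1..n} - A) \<le> card ({1..n} - B)"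
    using assms(3) assms(4)[of B] B by linarith
  then show "card B \<le> card A"
    using count[OF assms(1)] count[of B] B by linarith
qed (use assms in auto)

section \<open>Lower bounds for the number of gaps\<close>

text \<open>The target \<open>2 * n div c\<close> is the number of \<open>m > 0\<close> with \<open>c * m \<le> 2 * n\<close>. Suppose first that
  \<open>b * m \<in> B\<close> with \<open>n < c * m \<le> 2 * n\<close>, and put \<open>s = 2 * n - c * m\<close>. Passing from \<open>n\<close> to
  \<open>c * m - n - 1\<close> lowers the target by about \<open>2 * s / c \<le> s / 2\<close>, which is paid for by the window
  \<open>{c * m - n..n}\<close> of length \<open>s + 1\<close>, half of which are gaps.

  Otherwise let \<open>m\<close> be the largest index with \<open>b * m \<in> B\<close> and \<open>c * m \<le> n\<close>. The interval
  \<open>{1..c * m - 1}\<close> has at least as many gaps as it has multiples of \<open>b\<close>, because \<open>b \<ge> 2\<close>. The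
  remaining multiples \<open>b * m' \<ge> c * m\<close> with \<open>c * m' \<le> 2 * n\<close> satisfy \<open>m' > m\<close>, because \<open>c > b\<close>, so
  by maximality they are gaps themselves.\<close>

lemma missing_lower_bound_large_c:
  fixes b c :: nat
  assumes b: "b > 1" and c: "c > 2 * b"
    and av: "avoiding (\<lambda>x y z. b * (x + y) = c * z) B"
  shows "2 * n div c \<le> card ({1..n} - B)"
proof (induction n rule: less_induct)
  case (less n)
  show ?case
  proof (cases "\<exists>m. b * m \<in> B \<and> n < c * m \<and> c * m \<le> 2 * n")
    case True
    then obtain m where m: "b * m \<in> B" "n < c * m" "c * m \<le> 2 * n" by blast
    define D1 where "D1 = card ({1..c * m - n - 1} - B)"
    define D2 where "D2 = card ({c * m - n..n} - B)"
    define p where "p = 2 * (c * m - n - 1) div c"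
    define k where "k = 2 * n div c"
    define s where "s = 2 * n - c * m"
    have "D1 + D2 \<le> card ({1..n} - B)"
      unfolding D1_def D2_def using m by (intro missing_split) auto
    moreover have "p \<le> D1"
      unfolding p_def D1_def using m by (intro less.IH) auto
    moreover have win: "n + 1 - (c * m - n) \<le> 2 * D2"
      unfolding D2_def using m by (intro half_of_window_missing[OF av]) auto
    moreover have "k \<le> p + D2"
    proof -
      have "2 * (c * m - n - 1) < c * (p + 1)"
        unfolding p_def using c dividend_less_times_div[of c "2 * (c * m - n - 1)"] by simp
      moreover have kn: "c * k \<le> 2 * n" unfolding k_def by simp
      moreover have mk: "m \<le> k"
        unfolding k_def using m c by (simp add: less_eq_div_iff_mult_less_eq mult.commute)
      ultimately have ineqs: "int c * (int k - int m) \<le> int s"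
        "int c * (int m - 1 - int p) \<le> int s + 1"
        using m unfolding s_def by (simp_all add: algebra_simps of_nat_diff flip: of_nat_mult)
      have c4: "int c \<ge> 4" using b c by simp
      have t: "4 * (int k - int m) \<le> int s"
        using ineqs(1) mult_right_mono[OF c4, of "int k - int m"] mk by simp
      have v: "4 * (int m - 1 - int p) \<le> int s + 1"
      proof (cases "int m - 1 - int p \<ge> 0")
        case True
        then show ?thesis using ineqs(2) mult_right_mono[OF c4] by fastforce
      next
        case False
        then show ?thesis by simp
      qed
      have "int s + 1 \<le> 2 * int D2"
        using win m unfolding s_def by linarith
      with t v show ?thesis by presburger
    qed
    ultimately show ?thesis unfolding k_def by linarith
  next
    case no_window: False
    \<comment> \<open>The alternative \<open>m = 0\<close> covers the case that no suitable multiple lies in \<open>B\<close>: then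
      \<open>{1..c * m - 1}\<close> is empty and all multiples counted by the target are gaps.\<close>
    define P where "P m \<longleftrightarrow> (m = 0 \<or> b * m \<in> B) \<and> c * m \<le> n" for m
    define m where "m = (GREATEST m. P m)"
    have P_le: "y \<le> n" if "P y" for y
    proof -
      have "1 * y \<le> c * y" using c by (intro mult_right_mono) auto
      with that show ?thesis unfolding P_def by linarith
    qed
    have Pm: "P m"
      unfolding m_def by (rule GreatestI_nat[of P 0 n]) (use P_le in \<open>auto simp: P_def\<close>)
    have maximal: "m' \<le> m" if "P m'" for m'
      unfolding m_def by (rule Greatest_le_nat[of P m' n]) (use that P_le in auto)
    define q where "q = (c * m - 1) div b"
    define k where "k = 2 * n div c"
    have low: "c * m - 1 \<le> 2 * card ({1..c * m - 1} - B)"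
    proof (cases "m = 0")
      case False
      then have "b * m \<in> B" "c * m > 0" using Pm c by (auto simp: P_def)
      from half_of_window_missing[OF av this(1), of 1 "c * m - 1"] this(2)
      show ?thesis by simp
    qed simp
    have absent: "b * m' \<in> {max 1 (c * m)..n} - B" if m': "m' \<in> {q + 1..k}" for m'
    proof -
      have "c * m' \<le> 2 * n"
        using m' c unfolding k_def by (simp add: less_eq_div_iff_mult_less_eq mult.commute)
      moreover have "(2 * b) * m' \<le> c * m'" using c by (intro mult_right_mono) auto
      ultimately have le_n: "b * m' \<le> n" unfolding mult.assoc by linarith
      have "c * m - 1 < b * (q + 1)"
        unfolding q_def using b dividend_less_times_div[of b "c * m - 1"] by simp
      also have "\<dots> \<le> b * m'" using m' by (intro mult_left_mono) auto
      finally have ge: "c * m \<le> b * m'" by simp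
      have "b * m' < c * m'" using c m' by (intro mult_strict_right_mono) auto
      with ge have "m < m'" by (meson le_less_trans mult_less_cancel1)
      with maximal have "\<not> P m'" by (metis linorder_not_le)
      with no_window \<open>c * m' \<le> 2 * n\<close> m' have "b * m' \<notin> B"
        unfolding P_def by (metis linorder_not_le)
      moreover have "1 \<le> b * m'" using b m' by simp
      ultimately show ?thesis using le_n ge by simp
    qed
    have "card ((*) b ` {q + 1..k}) \<le> card ({max 1 (c * m)..n} - B)"
      using absent by (intro card_mono) auto
    moreover have "card ((*) b ` {q + 1..k}) = k - q"
      using b by (subst card_image) (auto simp: inj_on_def)
    moreover have "card ({1..c * m - 1} - B) + card ({max 1 (c * m)..n} - B) \<le> card ({1..n} - B)"
      using Pm by (intro missing_split) (auto simp: P_def)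
    moreover have "q \<le> card ({1..c * m - 1} - B)"
    proof -
      have "q \<le> (c * m - 1) div 2" unfolding q_def using b by (intro div_le_mono2) auto
      with low show ?thesis by linarith
    qed
    \<comment> \<open>Here \<open>q\<close> counts the multiples of \<open>b\<close> in \<open>{1..c * m - 1}\<close>; the gaps in that interval replace
      them, and the multiples with index in \<open>{q + 1..k}\<close> are gaps, which makes \<open>k\<close> in total.\<close>
    ultimately show ?thesis unfolding k_def by linarith
  qed
qed

text \<open>The target \<open>n div b\<close> only jumps when \<open>n = b * m\<close>, and such a jump is paid for by \<open>n\<close> itself
  unless \<open>n \<in> B\<close>. So let \<open>n = b * m \<in> B\<close>. If \<open>c * m \<le> n\<close>, then \<open>c \<ge> 2\<close> makes the half of
  \<open>{1..c * m - 1}\<close> that is missing large enough on its own: it has at least \<open>m\<close> elements.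
  Otherwise \<open>c < 2 * b\<close> gives \<open>c * m < 2 * n\<close>, so \<open>{c * m - n..n}\<close> is a nonempty window; at least
  half of it are gaps and, because \<open>b \<ge> 2\<close>, at most half of it, rounded up, are multiples of \<open>b\<close>.\<close>

lemma missing_lower_bound_medium_c:
  fixes b c :: nat
  assumes b: "b > 1" and c: "2 \<le> c" "c < 2 * b"
    and av: "avoiding (\<lambda>x y z. b * (x + y) = c * z) B"
  shows "n div b \<le> card ({1..n} - B)"
proof (induction n rule: less_induct)
  case (less n)
  consider "n = 0" | "n > 0" "\<not> b dvd n" | "n > 0" "n \<notin> B" | "n > 0" "b dvd n" "n \<in> B"
    by blast
  then show ?case
  proof cases
    case 1
    then show ?thesis by simp
  next
    case 2
    then have "n div b = (n - 1) div b"
      by (cases n) (auto simp: div_Suc dvd_eq_mod_eq_0)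
    also have "\<dots> \<le> card ({1..n - 1} - B)" using 2 by (intro less.IH) auto
    also have "\<dots> \<le> card ({1..n} - B)" by (intro missing_mono) auto
    finally show ?thesis .
  next
    case 3
    have "n div b \<le> (n - 1) div b + 1"
      by (cases n) (auto simp: div_Suc)
    moreover have "(n - 1) div b \<le> card ({1..n - 1} - B)" using 3 by (intro less.IH) auto
    moreover have "card ({1..n - 1} - B) + card ({n} - B) \<le> card ({1..n} - B)"
      using 3 by (intro missing_split) auto
    moreover have "card ({n} - B) = 1"
    proof -
      have "{n} - B = {n}" using 3 by auto
      then show ?thesis by simp
    qed
    ultimately show ?thesis by linarith
  next
    case 4
    then obtain m where m: "n = b * m" by blast
    have "m > 0" using 4 m by (cases m) auto
    have mB: "b * m \<in> B" using 4 m by simp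
    have "n div b = m" using m b by simp
    show ?thesis
    proof (cases "c * m \<le> n")
      case True
      have cm: "2 * m \<le> c * m" using c by simp
      have "(c * m - 1) + 1 - 1 \<le> 2 * card ({1..c * m - 1} - B)"
        using cm \<open>m > 0\<close> by (intro half_of_window_missing[OF av mB]) linarith
      moreover have "card ({1..c * m - 1} - B) \<le> card ({1..n} - B)"
        using True by (intro missing_mono) auto
      ultimately show ?thesis using \<open>n div b = m\<close> cm by linarith
    next
      case False
      have cm: "c * m < 2 * n"
        using c \<open>m > 0\<close> unfolding m by (simp flip: mult.assoc)
      define D1 where "D1 = card ({1..c * m - n - 1} - B)"
      define D2 where "D2 = card ({c * m - n..n} - B)"
      define p where "p = (c * m - n - 1) div b"
      define s where "s = 2 * n - c * m"
      have "D1 + D2 \<le> card ({1..n} - B)"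
        unfolding D1_def D2_def using False cm by (intro missing_split) auto
      moreover have "p \<le> D1"
        unfolding p_def D1_def using False cm by (intro less.IH) auto
      moreover have win: "n + 1 - (c * m - n) \<le> 2 * D2"
        unfolding D2_def using False cm by (intro half_of_window_missing[OF av mB]) auto
      moreover have "m \<le> p + D2"
      proof -
        have "c * m - n - 1 < b * (p + 1)"
          unfolding p_def using b dividend_less_times_div[of b "c * m - n - 1"] by simp
        then have v: "int b * (int m - 1 - int p) \<le> int s"
          using m cm False unfolding s_def
          by (simp add: algebra_simps of_nat_diff flip: of_nat_mult)
        have "2 * (int m - 1 - int p) \<le> int s"
        proof (cases "int m - 1 - int p \<ge> 0")
          case True
          then show ?thesis using v mult_right_mono[of 2 "int b" "int m - 1 - int p"] b by simp
        next
          case False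
          then show ?thesis by simp
        qed
        moreover have "int s + 1 \<le> 2 * int D2"
          using win False cm unfolding s_def by linarith
        ultimately show ?thesis by presburger
      qed
      ultimately show ?thesis using \<open>n div b = m\<close> by linarith
    qed
  qed
qed

text \<open>Each block of \<open>2 * b\<close> consecutive integers has to contribute a gap. Its last
  element \<open>2 * b * N\<close> is one, unless it lies in \<open>B\<close>; in that case the reflection \<open>x \<mapsto> 2 * N - x\<close>
  already produces \<open>N\<close> gaps below \<open>2 * N\<close>.\<close>

lemma missing_lower_bound_c_one:
  fixes b :: nat
  assumes b: "b > 0" and av: "avoiding (\<lambda>x y z. b * (x + y) = 1 * z) B"
  shows "N \<le> card ({1..2 * b * N} - B)"
proof (induction N)
  case (Suc N)
  show ?case
  proof (cases "b * (2 * Suc N) \<in> B")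
    case True
    have "(2 * N + 1) + 1 - 1 \<le> 2 * card ({1..2 * N + 1} - B)"
      by (rule half_of_window_missing[OF av True]) simp
    moreover have "card ({1..2 * N + 1} - B) \<le> card ({1..2 * b * Suc N} - B)"
    proof (rule missing_mono)
      have "2 * N + 1 \<le> 2 * Suc N" by simp
      also have "\<dots> \<le> (2 * b) * Suc N" using b by (intro mult_right_mono) auto
      finally show "{1..2 * N + 1} \<subseteq> {1..2 * b * Suc N}" by auto
    qed
    ultimately show ?thesis by linarith
  next
    case False
    have "card ({1..2 * b * N} - B) + card ({2 * b * Suc N} - B) \<le> card ({1..2 * b * Suc N} - B)"
      using b by (intro missing_split) auto
    moreover have "{2 * b * Suc N} - B = {2 * b * Suc N}" using False by (auto simp: algebra_simps)
    ultimately show ?thesis using Suc.IH by simp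
  qed
qed simp

section \<open>The extremal sets\<close>

lemma multiples_card_le:
  fixes b k :: nat
  assumes "\<And>x. x \<in> X \<Longrightarrow> \<exists>m\<in>{1..k}. x = b * m"
  shows "card X \<le> k"
proof -
  have "X \<subseteq> (*) b ` {1..k}" using assms by fastforce
  then have "card X \<le> card ((*) b ` {1..k})" by (intro card_mono) auto
  also have "\<dots> \<le> k" using card_image_le[of "{1..k}" "(*) b"] by simp
  finally show ?thesis .
qed

theorem theorem3p1:
  fixes b c :: nat and L :: "nat \<Rightarrow> nat \<Rightarrow> nat \<Rightarrow> bool"
  assumes "b > 1" and "c > 0" and "gcd b c = 1"
    and "L = (\<lambda>x y z. b * (x + y) = c * z)"
  shows "(c > 2 * b \<longrightarrow> (\<forall>n>0. max_avoiding_subset L n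
            ({x. 2 * real b * real n / real c < real x \<and> x \<le> n} \<union>
             {x. 1 \<le> x \<and> real x \<le> 2 * real b * real n / real c \<and> \<not> [x = 0] (mod b)})))
       \<and> (2 \<le> c \<and> c < 2 * b \<longrightarrow> (\<forall>n>0. max_avoiding_subset L n
            {x. 1 \<le> x \<and> x \<le> n \<and> \<not> [x = 0] (mod b)}))
       \<and> (c = 1 \<longrightarrow> (\<forall>n>0. max_avoiding_subset L n
            {x. real n / (2 * real b) < real x \<and> x \<le> n}))"
proof (intro conjI impI allI)
  have dvd: "b dvd z" if "L x y z" for x y z
  proof -
    have "b dvd c * z" using that assms(4) by (metis dvd_triv_left)
    moreover have "coprime b c" using assms(3) by (simp add: coprime_iff_gcd_eq_1)
    ultimately show ?thesis by (simp add: coprime_dvd_mult_right_iff)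
  qed
  have threshold: "2 * real b * real n / real c < real x \<longleftrightarrow> 2 * b * n < c * x" for n x
  proof -
    have "2 * real b * real n / real c < real x \<longleftrightarrow> real (2 * b * n) < real (c * x)"
      using assms(2) by (simp add: divide_less_eq mult.commute)
    then show ?thesis by (simp only: of_nat_less_iff)
  qed
  {
    fix n :: nat assume c: "c > 2 * b"
    let ?A = "{x. 2 * real b * real n / real c < real x \<and> x \<le> n} \<union>
             {x. 1 \<le> x \<and> real x \<le> 2 * real b * real n / real c \<and> \<not> [x = 0] (mod b)}"
    have A: "?A = {x. 1 \<le> x \<and> x \<le> n \<and> (2 * b * n < c * x \<or> \<not> b dvd x)}" (is "_ = ?A'")
    proof -
      have le: "x \<le> n" if "c * x \<le> 2 * b * n" for x
      proof -
        have "2 * b * n \<le> c * n" using c by (intro mult_right_mono) auto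
        with that have "c * x \<le> c * n" by linarith
        then show ?thesis using assms(2) by simp
      qed
      have pos: "1 \<le> x" if "2 * b * n < c * x" for x using that by (cases x) auto
      show ?thesis
        unfolding threshold not_less[symmetric] cong_0_iff
        using le pos by (auto simp: not_less Suc_le_eq)
    qed
    show "max_avoiding_subset L n ?A"
      unfolding A
    proof (rule max_avoiding_subsetI[where k = "2 * n div c"])
      show "avoiding L ?A'"
        unfolding avoiding_def
      proof clarify
        fix x y z
        assume xy: "x \<le> n" "y \<le> n" and L: "L x y z" and z: "2 * b * n < c * z \<or> \<not> b dvd z"
        from z dvd[OF L] have "2 * b * n < c * z" by blast
        also have "\<dots> = b * (x + y)" using L assms(4) by simp
        also have "\<dots> \<le> b * (2 * n)" using xy by (intro mult_left_mono) auto
        finally show False by simp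
      qed
      show "card ({1..n} - ?A') \<le> 2 * n div c"
      proof (rule multiples_card_le[where b = b])
        fix x assume x: "x \<in> {1..n} - ?A'"
        then obtain m where m: "x = b * m" by auto
        have "\<not> 2 * b * n < c * x" using x by auto
        then have "b * (c * m) \<le> b * (2 * n)" unfolding m not_less by (simp only: ac_simps)
        then have "c * m \<le> 2 * n" using assms(1) by simp
        then have "m \<le> 2 * n div c"
          using assms(2) by (simp add: less_eq_div_iff_mult_less_eq mult.commute)
        moreover have "m \<ge> 1" using x m by (cases m) auto
        ultimately show "\<exists>m\<in>{1..2 * n div c}. x = b * m" using m by auto
      qed
      show "2 * n div c \<le> card ({1..n} - B)" if "avoiding L B" for B
        using missing_lower_bound_large_c[OF assms(1) c] that assms(4) by simp
    qed auto
  }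
  {
    fix n :: nat assume c: "2 \<le> c \<and> c < 2 * b"
    let ?A = "{x. 1 \<le> x \<and> x \<le> n \<and> \<not> [x = 0] (mod b)}"
    show "max_avoiding_subset L n ?A"
    proof (rule max_avoiding_subsetI[where k = "n div b"])
      show "avoiding L ?A"
        unfolding avoiding_def using dvd by (auto simp: cong_0_iff)
      show "card ({1..n} - ?A) \<le> n div b"
      proof (rule multiples_card_le[where b = b])
        fix x assume x: "x \<in> {1..n} - ?A"
        then obtain m where m: "x = b * m" by (auto simp: cong_0_iff)
        with x have "m \<le> n div b"
          using assms(1) by (simp add: less_eq_div_iff_mult_less_eq mult.commute)
        moreover have "m \<ge> 1" using x m by (cases m) auto
        ultimately show "\<exists>m\<in>{1..n div b}. x = b * m" using m by auto
      qed
      show "n div b \<le> card ({1..n} - B)" if "avoiding L B" for B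
        using missing_lower_bound_medium_c[of b c B n] assms(1) c that unfolding assms(4) by blast
    qed auto
  }
  {
    fix n :: nat assume c: "c = 1"
    let ?A = "{x. real n / (2 * real b) < real x \<and> x \<le> n}"
    have A: "?A = {x. n < 2 * b * x \<and> x \<le> n}" (is "_ = ?A'")
    proof -
      have "real n / (2 * real b) < real x \<longleftrightarrow> real n < real (2 * b * x)" for x
        using assms(1) by (simp add: divide_less_eq mult.commute)
      then show ?thesis by (simp only: of_nat_less_iff)
    qed
    show "max_avoiding_subset L n ?A"
      unfolding A
    proof (rule max_avoiding_subsetI[where k = "n div (2 * b)"])
      have "1 \<le> x" if "n < 2 * b * x" for x using that by (cases x) auto
      then show "?A' \<subseteq> {1..n}" by auto
      show "avoiding L ?A'"
        unfolding avoiding_def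
      proof safe
        fix x y z
        assume "n < 2 * b * x" "n < 2 * b * y" "z \<le> n" "L x y z"
        then show False using assms(4) c by (simp add: algebra_simps)
      qed
      show "card ({1..n} - ?A') \<le> n div (2 * b)"
      proof (rule multiples_card_le[where b = 1])
        fix x assume "x \<in> {1..n} - ?A'"
        then show "\<exists>m\<in>{1..n div (2 * b)}. x = 1 * m"
          using assms(1) by (auto simp: less_eq_div_iff_mult_less_eq algebra_simps)
      qed
      show "n div (2 * b) \<le> card ({1..n} - B)" if "avoiding L B" for B
      proof -
        have "n div (2 * b) \<le> card ({1..2 * b * (n div (2 * b))} - B)"
          using missing_lower_bound_c_one[of b B] assms(1,4) that c by simp
        also have "\<dots> \<le> card ({1..n} - B)"
          by (intro missing_mono) (auto intro: order_trans[OF _ times_div_less_eq_dividend])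
        finally show ?thesis .
      qed
    qed
  }
qed

end
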